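(* Let $E_1,E_2$ and $F$ be Banach spaces over the same field $\mathbb K\in\{\mathbb R,\mathbb C\}$ and let $U\subseteq E_1\times E_2$ be open. Assume that $f\colon U\to F$ is differentiable at $x=(x_1,x_2)\in U$ with slope function $\Phi(x,\cdot)\colon U\to\mathcal L(E_1\times E_2,F)$. Let $U_{x_2}:=\{y_1\in E_1\colon(y_1,x_2)\in U\}$ and, for $y_1\in U_{x_2}$ and $z_1\in E_1$, define the partial slope function $\Phi_1$ by $$\Phi_1(x,y_1)z_1:=\Phi\bigl(x,(y_1,x_2)\bigr)(z_1,0).$$ Then the function $y_1\mapsto f(y_1,x_2)$ defined on $U_{x_2}$ is differentiable at $x_1$ with slope function $\Phi_1(x,\cdot)\colon U_{x_2}\to\mathcal L(E_1,F)$ at $x_1$ and derivative $D_1f(x_1,x_2)$ given by $D_1f(x_1,x_2)z_1=Df(x)(z_1,0)$ for all $z_1\in E_1$.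
   Context: $\mathcal L(E,F)$ denotes the space of bounded linear operators from $E$ to $F$ with the operator norm; $E_1\times E_2$ carries any of the usual equivalent product norms. Differentiability (in the sense of Carathéodory): for Banach spaces $E,F$ and $U\subseteq E$ open, $f\colon U\to F$ is differentiable at $x\in U$ if there exists a map $\Phi(x,\cdot)\colon U\to\mathcal L(E,F)$, continuous at $x$, such that $f(y)=f(x)+\Phi(x,y)(y-x)$ for all $y\in U$. Such a map is called a slope function of $f$ at $x$, and $Df(x):=\Phi(x,x)$ is the derivative of $f$ at $x$ (it does not depend on the choice of slope function). $D_1f(x_1,x_2)$ denotes the derivative at $x_1$ of $y_1\mapsto f(y_1,x_2)$. *)

theory Defs
  imports "HOL-Analysis.Analysis"
begin

text \<open>
  A Banach space over K is a type of class \<open>banach\<close> together with a scalar multiplication by K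
  extending the scalar multiplication by reals. The scalar field is any \<open>'k :: real_normed_field\<close>:
  by the theorems of Ostrowski and Gelfand-Mazur, up to isomorphism these are exactly
  the real and the complex numbers.
\<close>

locale banach_space_over = vector_space scale
  for scale :: "'k::real_normed_field \<Rightarrow> 'e::banach \<Rightarrow> 'e" +
  assumes norm_scale: "norm (scale a v) = norm a * norm v"
    and scale_of_real: "scale (of_real r) v = r *\<^sub>R v"

lemma banach_space_over_real: "banach_space_over (scaleR :: real \<Rightarrow> 'e::banach \<Rightarrow> 'e)"
  by unfold_locales (simp_all add: algebra_simps)

lemma banach_space_over_complex: "banach_space_over ((*) :: complex \<Rightarrow> complex \<Rightarrow> complex)"
  by unfold_locales (simp_all add: algebra_simps norm_mult scaleR_conv_of_real)

definition prod_scale :: "('k \<Rightarrow> 'a \<Rightarrow> 'a) \<Rightarrow> ('k \<Rightarrow> 'b \<Rightarrow> 'b) \<Rightarrow> 'k \<Rightarrow> 'a \<times> 'b \<Rightarrow> 'a \<times> 'b"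
  where "prod_scale s t a v = (s a (fst v), t a (snd v))"

lemma banach_space_over_prod:
  fixes s :: "'k::real_normed_field \<Rightarrow> 'a::banach \<Rightarrow> 'a" and t :: "'k \<Rightarrow> 'b::banach \<Rightarrow> 'b"
  assumes "banach_space_over s" and "banach_space_over t"
  shows "banach_space_over (prod_scale s t)"
proof -
  interpret s: banach_space_over s by fact
  interpret t: banach_space_over t by fact
  show ?thesis
  proof unfold_locales
    fix a :: 'k and v :: "'a \<times> 'b"
    have "(norm (s a (fst v)))\<^sup>2 + (norm (t a (snd v)))\<^sup>2
        = (norm a)\<^sup>2 * ((norm (fst v))\<^sup>2 + (norm (snd v))\<^sup>2)"
      by (simp add: s.norm_scale t.norm_scale algebra_simps power_mult_distrib)
    then show "norm (prod_scale s t a v) = norm a * norm v"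
      by (simp add: prod_scale_def norm_prod_def real_sqrt_mult)
  qed (auto simp: prod_scale_def prod_eq_iff s.scale_right_distrib t.scale_right_distrib
        s.scale_left_distrib t.scale_left_distrib s.scale_of_real t.scale_of_real)
qed

text \<open>
  The space of bounded K-linear operators. The type \<open>'e \<Rightarrow>\<^sub>L 'f\<close> consists of the bounded
  \<^emph>\<open>real\<close>-linear ones and carries the operator norm, which does not depend on the scalar field.
\<close>

definition bounded_ops ::
    "('k \<Rightarrow> 'e \<Rightarrow> 'e) \<Rightarrow> ('k \<Rightarrow> 'f \<Rightarrow> 'f) \<Rightarrow> ('e::real_normed_vector \<Rightarrow>\<^sub>L 'f::real_normed_vector) set"
  where "bounded_ops sE sF =
    {A. \<forall>a v. blinfun_apply A (sE a v) = sF a (blinfun_apply A v)}"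

text \<open>
  Functions on \<open>U\<close> are total functions of which only the values on \<open>U\<close> matter; \<open>\<Phi>\<close> stands for
  the map \<open>y \<mapsto> \<Phi>(x, y)\<close> with \<open>x\<close> fixed.
\<close>

definition slope_function ::
    "('k::real_normed_field \<Rightarrow> 'e \<Rightarrow> 'e) \<Rightarrow> ('k \<Rightarrow> 'f \<Rightarrow> 'f) \<Rightarrow> 'e set \<Rightarrow> ('e \<Rightarrow> 'f) \<Rightarrow> 'e
      \<Rightarrow> ('e::banach \<Rightarrow> 'e \<Rightarrow>\<^sub>L 'f::banach) \<Rightarrow> bool"
  where "slope_function sE sF U f x \<Phi> \<longleftrightarrow>
    open U \<and> x \<in> U \<and>
    \<Phi> ` U \<subseteq> bounded_ops sE sF \<and>
    continuous (at x within U) \<Phi> \<and>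
    (\<forall>y\<in>U. f y = f x + blinfun_apply (\<Phi> y) (y - x))"

definition slope_differentiable ::
    "('k::real_normed_field \<Rightarrow> 'e \<Rightarrow> 'e) \<Rightarrow> ('k \<Rightarrow> 'f \<Rightarrow> 'f) \<Rightarrow> 'e set \<Rightarrow> ('e::banach \<Rightarrow> 'f::banach)
      \<Rightarrow> 'e \<Rightarrow> bool"
  where "slope_differentiable sE sF U f x \<longleftrightarrow> (\<exists>\<Phi>. slope_function sE sF U f x \<Phi>)"

definition slope_derivative ::
    "('k::real_normed_field \<Rightarrow> 'e \<Rightarrow> 'e) \<Rightarrow> ('k \<Rightarrow> 'f \<Rightarrow> 'f) \<Rightarrow> 'e set \<Rightarrow> ('e::banach \<Rightarrow> 'f::banach)
      \<Rightarrow> 'e \<Rightarrow> 'e \<Rightarrow>\<^sub>L 'f"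
  where "slope_derivative sE sF U f x = (THE A. \<exists>\<Phi>. slope_function sE sF U f x \<Phi> \<and> A = \<Phi> x)"

lemma slope_function_unique_at:
  assumes "slope_function sE sF U f x \<Phi>" and "slope_function sE sF U f x \<Psi>"
  shows "\<Phi> x = \<Psi> x"
proof (rule blinfun_eqI)
  fix z
  have U: "open U" "x \<in> U" using assms unfolding slope_function_def by blast+
  have "continuous (at x within U) \<Phi>" "continuous (at x within U) \<Psi>"
    using assms unfolding slope_function_def by blast+
  then have cont: "isCont \<Phi> x" "isCont \<Psi> x"
    by (simp_all add: at_within_open[OF U(2,1)])
  define g where "g = (\<lambda>t::real. x + t *\<^sub>R z)"
  have g: "(g \<longlongrightarrow> x) (at 0)"
    unfolding g_def by (auto intro!: tendsto_eq_intros)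
  define h where "h = (\<lambda>t. blinfun_apply (\<Phi> (g t)) z - blinfun_apply (\<Psi> (g t)) z)"
  have lim: "(h \<longlongrightarrow> blinfun_apply (\<Phi> x) z - blinfun_apply (\<Psi> x) z) (at 0)"
    unfolding h_def
    by (intro tendsto_diff blinfun.tendsto tendsto_const isCont_tendsto_compose[OF cont(1) g]
        isCont_tendsto_compose[OF cont(2) g])
  have "\<forall>\<^sub>F t in at 0. g t \<in> U"
    using topological_tendstoD[OF g U] .
  moreover have "\<forall>\<^sub>F t::real in at 0. t \<noteq> 0"
    by (simp add: eventually_at_filter)
  ultimately have "\<forall>\<^sub>F t in at 0. h t = 0"
  proof eventually_elim
    case (elim t)
    have "f (g t) = f x + blinfun_apply (\<Phi> (g t)) (g t - x)"
      and "f (g t) = f x + blinfun_apply (\<Psi> (g t)) (g t - x)"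
      using assms elim(1) unfolding slope_function_def by blast+
    then have "blinfun_apply (\<Phi> (g t)) (g t - x) = blinfun_apply (\<Psi> (g t)) (g t - x)"
      by simp
    then show ?case
      using elim(2) by (simp add: g_def h_def blinfun.scaleR_right)
  qed
  then have "(h \<longlongrightarrow> 0) (at 0)" by (simp add: tendsto_eventually)
  from tendsto_unique[OF _ lim this] show "blinfun_apply (\<Phi> x) z = blinfun_apply (\<Psi> x) z"
    by simp
qed

lemma slope_derivative_eq:
  assumes "slope_function sE sF U f x \<Phi>"
  shows "slope_derivative sE sF U f x = \<Phi> x"
  unfolding slope_derivative_def
proof (rule the_equality)
  show "\<exists>\<Psi>. slope_function sE sF U f x \<Psi> \<and> \<Phi> x = \<Psi> x"
    by (intro exI conjI) (rule assms, rule refl)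
next
  fix A assume "\<exists>\<Psi>. slope_function sE sF U f x \<Psi> \<and> A = \<Psi> x"
  then obtain \<Psi> where "slope_function sE sF U f x \<Psi>" "A = \<Psi> x" by (elim exE conjE)
  then show "A = \<Phi> x" using slope_function_unique_at[OF _ assms] by simp
qed

definition slice1 :: "('a \<times> 'b) set \<Rightarrow> 'b \<Rightarrow> 'a set"
  where "slice1 U x2 = {y1. (y1, x2) \<in> U}"

text \<open>
  \<open>Blinfun\<close> is only meaningful on bounded linear maps; the map below is one, being a restriction
  of a bounded linear operator on the product.
\<close>

definition partial_slope1 ::
    "('a::real_normed_vector \<times> 'b::real_normed_vector \<Rightarrow> ('a \<times> 'b) \<Rightarrow>\<^sub>L 'f) \<Rightarrow> 'b \<Rightarrow> 'a
      \<Rightarrow> 'a \<Rightarrow>\<^sub>L 'f::real_normed_vector"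
  where "partial_slope1 \<Phi> x2 y1 = Blinfun (\<lambda>z1. blinfun_apply (\<Phi> (y1, x2)) (z1, 0))"

definition partial_derivative1 ::
    "('k::real_normed_field \<Rightarrow> 'a \<Rightarrow> 'a) \<Rightarrow> ('k \<Rightarrow> 'f \<Rightarrow> 'f) \<Rightarrow> ('a \<times> 'b) set
      \<Rightarrow> ('a::banach \<times> 'b \<Rightarrow> 'f::banach) \<Rightarrow> 'a \<Rightarrow> 'b \<Rightarrow> 'a \<Rightarrow>\<^sub>L 'f"
  where "partial_derivative1 sE1 sF U f x1 x2 =
    slope_derivative sE1 sF (slice1 U x2) (\<lambda>y1. f (y1, x2)) x1"

end

theory Submission imports Defs
begin

text \<open>
  Freezing the second coordinate means composing with the affine map \<open>y1 \<mapsto> (y1, x2)\<close>, whose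
  linear part is the inclusion \<open>J z = (z, 0)\<close>. Since \<open>(y1, x2) - (x1, x2) = J (y1 - x1)\<close>, the slope
  equation of \<open>f\<close> at points of the slice is a slope equation for \<open>y1 \<mapsto> f (y1, x2)\<close> with slope
  \<open>\<Phi> (y1, x2) \<circ> J\<close>. The remaining properties pass through this description
  (\<open>partial_slope1_eq_compose\<close>): composition with the fixed operator \<open>J\<close> is continuous in the
  operator norm, and \<open>J\<close> commutes with scalars. The formula for the derivative is then the slope
  evaluated at \<open>x1\<close>, by uniqueness of the derivative.
\<close>

definition inclusion1 :: "'a::real_normed_vector \<Rightarrow>\<^sub>L ('a \<times> 'b::real_normed_vector)"
  where "inclusion1 = Blinfun (\<lambda>z. (z, 0))"

lemma inclusion1_apply [simp]: "blinfun_apply inclusion1 z = (z, 0)"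
  unfolding inclusion1_def
  by (subst bounded_linear_Blinfun_apply)
    (rule bounded_linear_Pair bounded_linear_ident bounded_linear_zero refl)+

text \<open>
  As a composition of bounded operators, the partial slope is visibly bounded, so \<open>Blinfun\<close> is
  applied to a bounded linear map in its definition, and its dependence on \<open>\<Phi>\<close> is continuous.
\<close>

lemma partial_slope1_eq_compose: "partial_slope1 \<Phi> x2 y1 = \<Phi> (y1, x2) o\<^sub>L inclusion1"
proof -
  have "(\<lambda>z. blinfun_apply (\<Phi> (y1, x2)) (z, 0)) = blinfun_apply (\<Phi> (y1, x2) o\<^sub>L inclusion1)"
    by (simp add: fun_eq_iff)
  then show ?thesis
    by (simp add: partial_slope1_def blinfun_apply_inverse)
qed

lemma partial_slope1_apply:
  "blinfun_apply (partial_slope1 \<Phi> x2 y1) z = blinfun_apply (\<Phi> (y1, x2)) (z, 0)"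
  by (simp add: partial_slope1_eq_compose)

lemma open_slice1:
  fixes U :: "('a::topological_space \<times> 'b::topological_space) set"
  assumes "open U"
  shows "open (slice1 U x2)"
proof -
  have "slice1 U x2 = (\<lambda>y. (y, x2)) -` U"
    by (auto simp: slice1_def)
  then show ?thesis
    using assms by (auto intro!: open_vimage continuous_intros)
qed

text \<open>
  Scalars commute with the partial slope because those of the second factor fix \<open>0\<close>.
\<close>

lemma partial_slope1_in_bounded_ops:
  assumes "vector_space sE2" and "\<Phi> (y1, x2) \<in> bounded_ops (prod_scale sE1 sE2) sF"
  shows "partial_slope1 \<Phi> x2 y1 \<in> bounded_ops sE1 sF"
proof -
  interpret sE2: vector_space sE2 by fact
  have "(sE1 a z, 0) = prod_scale sE1 sE2 a (z, 0)" for a z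
    by (simp add: prod_scale_def)
  then show ?thesis
    using assms(2) by (simp add: bounded_ops_def partial_slope1_apply)
qed

lemma continuous_partial_slope1:
  assumes "continuous (at (x1, x2) within U) \<Phi>"
  shows "continuous (at x1 within slice1 U x2) (partial_slope1 \<Phi> x2)"
proof -
  have "(\<lambda>y. (y, x2)) ` slice1 U x2 \<subseteq> U"
    by (auto simp: slice1_def)
  with assms have "continuous (at (x1, x2) within (\<lambda>y. (y, x2)) ` slice1 U x2) \<Phi>"
    by (rule continuous_within_subset)
  moreover have "continuous (at x1 within slice1 U x2) (\<lambda>y. (y, x2))"
    by (rule continuous_Pair[OF continuous_ident continuous_const])
  ultimately have "continuous (at x1 within slice1 U x2) (\<lambda>y. \<Phi> (y, x2))"
    by (rule continuous_within_compose2[rotated])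
  then show ?thesis
    unfolding partial_slope1_eq_compose[abs_def]
    by (rule bounded_bilinear.continuous[OF bounded_bilinear_blinfun_compose _ continuous_const])
qed

lemma slope_function_partial_slope1:
  assumes "vector_space sE2" and \<Phi>: "slope_function (prod_scale sE1 sE2) sF U f (x1, x2) \<Phi>"
  shows "slope_function sE1 sF (slice1 U x2) (\<lambda>y1. f (y1, x2)) x1 (partial_slope1 \<Phi> x2)"
proof -
  have U: "open U" "(x1, x2) \<in> U" and ops: "\<Phi> ` U \<subseteq> bounded_ops (prod_scale sE1 sE2) sF"
    and cont: "continuous (at (x1, x2) within U) \<Phi>"
    and slope: "\<forall>y\<in>U. f y = f (x1, x2) + blinfun_apply (\<Phi> y) (y - (x1, x2))"
    using \<Phi> unfolding slope_function_def by blast+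
  show ?thesis
    unfolding slope_function_def
  proof (intro conjI ballI)
    show "open (slice1 U x2)"
      using U(1) by (rule open_slice1)
    show "x1 \<in> slice1 U x2"
      using U(2) by (simp add: slice1_def)
    show "partial_slope1 \<Phi> x2 ` slice1 U x2 \<subseteq> bounded_ops sE1 sF"
      using ops by (auto simp: slice1_def intro!: partial_slope1_in_bounded_ops[OF assms(1)])
    show "continuous (at x1 within slice1 U x2) (partial_slope1 \<Phi> x2)"
      using cont by (rule continuous_partial_slope1)
  next
    fix y1 assume "y1 \<in> slice1 U x2"
    then have "(y1, x2) \<in> U"
      by (simp add: slice1_def)
    with slope have "f (y1, x2) = f (x1, x2) + blinfun_apply (\<Phi> (y1, x2)) ((y1, x2) - (x1, x2))"
      by (rule bspec)
    then show "f (y1, x2) = f (x1, x2) + blinfun_apply (partial_slope1 \<Phi> x2 y1) (y1 - x1)"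
      by (simp add: partial_slope1_apply)
  qed
qed

theorem proposition3p5:
  fixes sE1 :: "'k::real_normed_field \<Rightarrow> 'a::banach \<Rightarrow> 'a"
    and sE2 :: "'k \<Rightarrow> 'b::banach \<Rightarrow> 'b"
    and sF :: "'k \<Rightarrow> 'f::banach \<Rightarrow> 'f"
    and U :: "('a \<times> 'b) set"
    and f :: "'a \<times> 'b \<Rightarrow> 'f"
    and x1 :: 'a and x2 :: 'b
    and \<Phi> :: "'a \<times> 'b \<Rightarrow> ('a \<times> 'b) \<Rightarrow>\<^sub>L 'f"
  assumes "banach_space_over sE1" and "banach_space_over sE2" and "banach_space_over sF"
    and "open U" and "(x1, x2) \<in> U"
    and "slope_function (prod_scale sE1 sE2) sF U f (x1, x2) \<Phi>"
  shows "(\<forall>y1\<in>slice1 U x2. \<forall>z1.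
            blinfun_apply (partial_slope1 \<Phi> x2 y1) z1 = blinfun_apply (\<Phi> (y1, x2)) (z1, 0))
       \<and> slope_differentiable sE1 sF (slice1 U x2) (\<lambda>y1. f (y1, x2)) x1
       \<and> slope_function sE1 sF (slice1 U x2) (\<lambda>y1. f (y1, x2)) x1 (partial_slope1 \<Phi> x2)
       \<and> (\<forall>z1. blinfun_apply (partial_derivative1 sE1 sF U f x1 x2) z1
            = blinfun_apply (slope_derivative (prod_scale sE1 sE2) sF U f (x1, x2)) (z1, 0))"
proof -
  have "vector_space sE2"
    using assms(2) by (rule banach_space_over.axioms(1))
  then have slope: "slope_function sE1 sF (slice1 U x2) (\<lambda>y1. f (y1, x2)) x1 (partial_slope1 \<Phi> x2)"
    using assms(6) by (rule slope_function_partial_slope1)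
  have "partial_derivative1 sE1 sF U f x1 x2 = partial_slope1 \<Phi> x2 x1"
    using slope unfolding partial_derivative1_def by (rule slope_derivative_eq)
  moreover have "slope_differentiable sE1 sF (slice1 U x2) (\<lambda>y1. f (y1, x2)) x1"
    using slope unfolding slope_differentiable_def by blast
  ultimately show ?thesis
    using slope by (simp add: partial_slope1_apply slope_derivative_eq[OF assms(6)])
qed

end
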